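(* For every $\varepsilon > 0$, there exists a deterministic algorithm for the Submodular Maximization subject to a Cardinality Constraint problem (SMC) which runs in $O(n/\varepsilon)$ time and always outputs a feasible set $S$ with $f(S) \geq (1 - 1/e - \varepsilon) \cdot f(OPT)$, where $OPT$ is an optimal solution.
   Context: SMC: given a finite ground set $\mathcal{N}$ with $|\mathcal{N}| = n$, an integer $1 \leq k \leq n$, and a non-negative monotone submodular function $f\colon 2^{\mathcal{N}} \to \mathbb{R}_{\geq 0}$ accessible through a value oracle (returning $f(S)$ for a queried $S$), find a set $S \subseteq \mathcal{N}$ with $|S| \leq k$ maximizing $f(S)$. Here $f$ is submodular if $f(S \cup \{u\}) - f(S) \geq f(T \cup \{u\}) - f(T)$ for all $S \subseteq T \subseteq \mathcal{N}$ and $u \notin T$, and monotone if $f(S) \leq f(T)$ whenever $S \subseteq T$. Running time counts each value oracle query as a unit-cost operation. *)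

theory Defs
  imports Complex_Main
begin

definition submodular_on :: "'a set \<Rightarrow> ('a set \<Rightarrow> real) \<Rightarrow> bool" where
  "submodular_on N f \<longleftrightarrow>
     (\<forall>S T u. S \<subseteq> T \<and> T \<subseteq> N \<and> u \<in> N \<and> u \<notin> T \<longrightarrow>
        f (S \<union> {u}) - f S \<ge> f (T \<union> {u}) - f T)"

definition monotone_set_function_on :: "'a set \<Rightarrow> ('a set \<Rightarrow> real) \<Rightarrow> bool" where
  "monotone_set_function_on N f \<longleftrightarrow> (\<forall>S T. S \<subseteq> T \<and> T \<subseteq> N \<longrightarrow> f S \<le> f T)"

definition nonnegative_on :: "'a set \<Rightarrow> ('a set \<Rightarrow> real) \<Rightarrow> bool" where
  "nonnegative_on N f \<longleftrightarrow> (\<forall>S. S \<subseteq> N \<longrightarrow> 0 \<le> f S)"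

definition smc_instance :: "'a set \<Rightarrow> nat \<Rightarrow> ('a set \<Rightarrow> real) \<Rightarrow> bool" where
  "smc_instance N k f \<longleftrightarrow>
     finite N \<and> 1 \<le> k \<and> k \<le> card N \<and>
     nonnegative_on N f \<and> monotone_set_function_on N f \<and> submodular_on N f"

definition feasible :: "'a set \<Rightarrow> nat \<Rightarrow> 'a set \<Rightarrow> bool" where
  "feasible N k S \<longleftrightarrow> S \<subseteq> N \<and> card S \<le> k"

definition optimal_solution :: "'a set \<Rightarrow> nat \<Rightarrow> ('a set \<Rightarrow> real) \<Rightarrow> 'a set \<Rightarrow> bool" where
  "optimal_solution N k f S \<longleftrightarrow> is_arg_max f (feasible N k) S"

text \<open>
  The model of computation is a unit-cost random access machine with three memories: integer
  cells, real cells, and set cells.  Programs are structured commands; every instruction and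
  every evaluation of a branching condition costs one time unit, in particular every oracle query.

  A set cell plays the role of the characteristic vector of a subset of the ground set.  It can
  only be changed or inspected one element at a time, and elements are addressed by their position
  in the enumeration by which the ground set is presented.  There is no unit-cost way to copy,
  combine, or count sets.  Real arithmetic is exact; there is no rounding instruction, and
  programs contain only natural and rational constants.
\<close>

type_synonym addr = nat

datatype instr =
    NConst addr nat
  | NAdd addr addr addr
  | NSub addr addr addr
  | NLoad addr addr
  | NStore addr addr
  | RConst addr rat
  | RAdd addr addr addr
  | RSub addr addr addr
  | RMul addr addr addr
  | RDiv addr addr addr
  | RLoad addr addr
  | RStore addr addr
  | ROfNat addr addr
  | SInsert addr addr
  | SRemove addr addr
  | Query addr addr

datatype test =
    NLess addr addr
  | NEq addr addr
  | RLess addr addr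
  | REq addr addr
  | SMember addr addr

datatype com =
    Skip
  | Do instr
  | Seq com com
  | Branch test com com
  | Loop test com

record 'a state =
  nmem :: "addr \<Rightarrow> nat"
  rmem :: "addr \<Rightarrow> real"
  smem :: "addr \<Rightarrow> 'a set"

definition set_nmem :: "addr \<Rightarrow> nat \<Rightarrow> 'a state \<Rightarrow> 'a state" where
  "set_nmem d v s = s\<lparr>nmem := (nmem s)(d := v)\<rparr>"

definition set_rmem :: "addr \<Rightarrow> real \<Rightarrow> 'a state \<Rightarrow> 'a state" where
  "set_rmem d v s = s\<lparr>rmem := (rmem s)(d := v)\<rparr>"

definition set_smem :: "addr \<Rightarrow> 'a set \<Rightarrow> 'a state \<Rightarrow> 'a state" where
  "set_smem d v s = s\<lparr>smem := (smem s)(d := v)\<rparr>"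

text \<open>
  The ground set element addressed by integer cell \<open>i\<close>, as a set with at most one member; it is
  empty if the content of the cell is not a valid position.
\<close>

definition element_at :: "'a list \<Rightarrow> 'a state \<Rightarrow> addr \<Rightarrow> 'a set" where
  "element_at xs s i = (if nmem s i < length xs then {xs ! nmem s i} else {})"

text \<open>
  The first address of an instruction is the destination; for \<open>NStore\<close> and \<open>RStore\<close> it is the
  cell holding the destination address.
\<close>

fun step :: "'a list \<Rightarrow> ('a set \<Rightarrow> real) \<Rightarrow> instr \<Rightarrow> 'a state \<Rightarrow> 'a state" where
  "step xs f (NConst d c) s = set_nmem d c s"
| "step xs f (NAdd d i j) s = set_nmem d (nmem s i + nmem s j) s"
| "step xs f (NSub d i j) s = set_nmem d (nmem s i - nmem s j) s"
| "step xs f (NLoad d i) s = set_nmem d (nmem s (nmem s i)) s"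
| "step xs f (NStore d i) s = set_nmem (nmem s d) (nmem s i) s"
| "step xs f (RConst d q) s = set_rmem d (of_rat q) s"
| "step xs f (RAdd d i j) s = set_rmem d (rmem s i + rmem s j) s"
| "step xs f (RSub d i j) s = set_rmem d (rmem s i - rmem s j) s"
| "step xs f (RMul d i j) s = set_rmem d (rmem s i * rmem s j) s"
| "step xs f (RDiv d i j) s = set_rmem d (rmem s i / rmem s j) s"
| "step xs f (RLoad d i) s = set_rmem d (rmem s (nmem s i)) s"
| "step xs f (RStore d i) s = set_rmem (nmem s d) (rmem s i) s"
| "step xs f (ROfNat d i) s = set_rmem d (real (nmem s i)) s"
| "step xs f (SInsert d i) s = set_smem d (smem s d \<union> element_at xs s i) s"
| "step xs f (SRemove d i) s = set_smem d (smem s d - element_at xs s i) s"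
| "step xs f (Query d i) s = set_rmem d (f (smem s i)) s"

fun holds :: "'a list \<Rightarrow> test \<Rightarrow> 'a state \<Rightarrow> bool" where
  "holds xs (NLess i j) s \<longleftrightarrow> nmem s i < nmem s j"
| "holds xs (NEq i j) s \<longleftrightarrow> nmem s i = nmem s j"
| "holds xs (RLess i j) s \<longleftrightarrow> rmem s i < rmem s j"
| "holds xs (REq i j) s \<longleftrightarrow> rmem s i = rmem s j"
| "holds xs (SMember d i) s \<longleftrightarrow> smem s d \<inter> element_at xs s i \<noteq> {}"

text \<open>
  \<open>exec xs f c s t s'\<close>: started in state \<open>s\<close>, command \<open>c\<close> terminates after exactly \<open>t\<close> time
  units in state \<open>s'\<close>.  The empty program \<open>Skip\<close> performs no operation and takes no time.
\<close>

inductive exec ::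
  "'a list \<Rightarrow> ('a set \<Rightarrow> real) \<Rightarrow> com \<Rightarrow> 'a state \<Rightarrow> nat \<Rightarrow> 'a state \<Rightarrow> bool"
  for xs :: "'a list" and f :: "'a set \<Rightarrow> real" where
  Skip: "exec xs f Skip s 0 s"
| Do: "exec xs f (Do i) s 1 (step xs f i s)"
| Seq: "exec xs f c1 s t1 s1 \<Longrightarrow> exec xs f c2 s1 t2 s2 \<Longrightarrow>
    exec xs f (Seq c1 c2) s (t1 + t2) s2"
| BranchTrue: "holds xs b s \<Longrightarrow> exec xs f c1 s t s' \<Longrightarrow>
    exec xs f (Branch b c1 c2) s (1 + t) s'"
| BranchFalse: "\<not> holds xs b s \<Longrightarrow> exec xs f c2 s t s' \<Longrightarrow>
    exec xs f (Branch b c1 c2) s (1 + t) s'"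
| LoopFalse: "\<not> holds xs b s \<Longrightarrow> exec xs f (Loop b c) s 1 s"
| LoopTrue: "holds xs b s \<Longrightarrow> exec xs f c s t1 s1 \<Longrightarrow> exec xs f (Loop b c) s1 t2 s2 \<Longrightarrow>
    exec xs f (Loop b c) s (1 + t1 + t2) s2"

inductive_cases exec_SkipE: "exec xs f Skip s t s'"
inductive_cases exec_DoE: "exec xs f (Do i) s t s'"
inductive_cases exec_SeqE: "exec xs f (Seq c1 c2) s t s'"
inductive_cases exec_BranchE: "exec xs f (Branch b c1 c2) s t s'"
inductive_cases exec_LoopE: "exec xs f (Loop b c) s t s'"

lemma exec_deterministic:
  "exec xs f c s t s' \<Longrightarrow> exec xs f c s u s'' \<Longrightarrow> t = u \<and> s' = s''"
proof (induction arbitrary: u s'' rule: exec.induct)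
  case (Skip s)
  then show ?case by (auto elim: exec_SkipE)
next
  case (Do i s)
  then show ?case by (auto elim: exec_DoE)
next
  case (Seq c1 s t1 s1 c2 t2 s2)
  from Seq.prems obtain u1 r1 u2 where
    "exec xs f c1 s u1 r1" "exec xs f c2 r1 u2 s''" "u = u1 + u2"
    by (auto elim: exec_SeqE)
  with Seq.IH show ?case by metis
next
  case (BranchTrue b s c1 t s' c2)
  from BranchTrue.prems BranchTrue.hyps obtain u1 where
    "exec xs f c1 s u1 s''" "u = 1 + u1"
    by (auto elim: exec_BranchE)
  with BranchTrue.IH show ?case by metis
next
  case (BranchFalse b s c2 t s' c1)
  from BranchFalse.prems BranchFalse.hyps obtain u1 where
    "exec xs f c2 s u1 s''" "u = 1 + u1"
    by (auto elim: exec_BranchE)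
  with BranchFalse.IH show ?case by metis
next
  case (LoopFalse b s c)
  then show ?case by (auto elim: exec_LoopE)
next
  case (LoopTrue b s c t1 s1 t2 s2)
  have "\<exists>u1 r1 u2. u = 1 + u1 + u2 \<and> exec xs f c s u1 r1 \<and> exec xs f (Loop b c) r1 u2 s''"
    using LoopTrue.prems by (rule exec_LoopE) (use LoopTrue.hyps in auto)
  with LoopTrue.IH show ?case by metis
qed

definition initial_state :: "nat \<Rightarrow> nat \<Rightarrow> 'a state" where
  "initial_state n k = \<lparr>nmem = (\<lambda>_. 0)(0 := n, 1 := k), rmem = (\<lambda>_. 0), smem = (\<lambda>_. {})\<rparr>"

text \<open>
  On the ground set enumerated by \<open>xs\<close>, cardinality bound \<open>k\<close> and value oracle \<open>f\<close>, program \<open>P\<close>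
  halts after \<open>t\<close> time units with output \<open>S\<close>, which is read off set cell \<open>0\<close>.
\<close>

definition outputs_in_time ::
  "com \<Rightarrow> 'a list \<Rightarrow> nat \<Rightarrow> ('a set \<Rightarrow> real) \<Rightarrow> nat \<Rightarrow> 'a set \<Rightarrow> bool" where
  "outputs_in_time P xs k f t S \<longleftrightarrow>
     (\<exists>s'. exec xs f P (initial_state (length xs) k) t s' \<and> S = smem s' 0)"

lemma outputs_in_time_deterministic:
  "outputs_in_time P xs k f t S \<Longrightarrow> outputs_in_time P xs k f u T \<Longrightarrow> t = u \<and> S = T"
  unfolding outputs_in_time_def by (blast dest: exec_deterministic)

end

theory Submission
  imports Defs
begin

text \<open>
  A single scan that adds an element to \<open>A\<close> whenever this raises the value by at least \<open>f A / k\<close>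
  yields \<open>f OPT / 2 \<le> f A \<le> 2 f OPT\<close>: the rejected elements gain at most \<open>f A / k\<close> each, and
  since every addition multiplies the value by at least \<open>1 + 1/k\<close>, the last \<open>k\<close> added elements
  already carry half of the value of \<open>A\<close>.

  Threshold greedy is then run from \<open>2 f A / k \<ge> f OPT / k\<close> downwards with ratio \<open>a = 1 - 1/q\<close>,
  where \<open>q\<close> is about \<open>1/\<epsilon>\<close>. Each accepted element closes an \<open>a/k\<close> fraction of the gap to the
  optimum, so \<open>k\<close> acceptances suffice. If fewer are made, the gap is at most \<open>k\<close> times the last
  threshold; the thresholds only need to drop to about \<open>f OPT / (e k)\<close>, a constant factor below
  the first one, so \<open>O(1/\<epsilon>)\<close> passes are enough.
\<close>

section \<open>Submodular functions\<close>

text \<open>Monotonicity extends diminishing returns to \<open>u \<in> T\<close>: there the gain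
  over \<open>T\<close> is 0, and the gain over \<open>S\<close> is nonnegative.\<close>

lemma gain_antimono:
  assumes "submodular_on N f" "monotone_set_function_on N f" "S \<subseteq> T" "T \<subseteq> N" "u \<in> N"
  shows "f (T \<union> {u}) - f T \<le> f (S \<union> {u}) - f S"
proof (cases "u \<in> T")
  case True
  then have "T \<union> {u} = T" by auto
  moreover have "f S \<le> f (S \<union> {u})"
    using assms unfolding monotone_set_function_on_def by (meson Un_upper1 Un_least empty_subsetI
        insert_subset order_trans)
  ultimately show ?thesis by simp
next
  case False
  with assms show ?thesis unfolding submodular_on_def by blast
qed

lemma union_gain_le:
  assumes "submodular_on N f" "monotone_set_function_on N f" "S \<subseteq> N"
    and "finite X" "X \<subseteq> N" "\<And>u. u \<in> X \<Longrightarrow> f (S \<union> {u}) - f S \<le> b"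
  shows "f (S \<union> X) - f S \<le> real (card X) * b"
  using assms(4-6)
proof (induction X rule: finite_induct)
  case empty
  then show ?case by simp
next
  case (insert u X)
  have "f ((S \<union> X) \<union> {u}) - f (S \<union> X) \<le> f (S \<union> {u}) - f S"
    using insert.prems assms(1-3) by (intro gain_antimono[of N]) auto
  also have "\<dots> \<le> b" using insert.prems by simp
  finally have "f (S \<union> insert u X) - f (S \<union> X) \<le> b" by simp
  moreover have "f (S \<union> X) - f S \<le> real (card X) * b"
    using insert.IH insert.prems by simp
  ultimately show ?case using insert.hyps by (simp add: algebra_simps)
qed

text \<open>Monotonicity gives \<open>f X \<le> f (S \<union> X)\<close>; adding \<open>X\<close> to
  \<open>S\<close> one element at a time then costs at most \<open>b\<close> per element. Applied
  with \<open>X = OPT\<close> after the scan and after every greedy pass.\<close>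

lemma gap_le_card_times_gain:
  assumes "submodular_on N f" "monotone_set_function_on N f" "finite N" "S \<subseteq> N"
    and "feasible N k X" "\<And>u. u \<in> N \<Longrightarrow> f (S \<union> {u}) - f S \<le> b" "0 \<le> b"
  shows "f X - f S \<le> real k * b"
proof -
  have X: "X \<subseteq> N" "card X \<le> k" using assms(5) by (auto simp: feasible_def)
  have "f X \<le> f (S \<union> X)"
    using X assms(2,4) unfolding monotone_set_function_on_def by (meson Un_least Un_upper2)
  moreover have "f (S \<union> X) - f S \<le> real (card X) * b"
    using X assms by (intro union_gain_le[of N]) (auto intro: finite_subset)
  moreover have "real (card X) * b \<le> real k * b"
    using X assms(7) by (intro mult_right_mono) auto
  ultimately show ?thesis by linarith
qed

lemma optimal_solution_exists:
  assumes "finite N"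
  shows "\<exists>X. optimal_solution N k f X"
proof -
  have fin: "finite {X. feasible N k X}"
    by (rule finite_subset[of _ "Pow N"]) (use assms in \<open>auto simp: feasible_def\<close>)
  let ?M = "Max (f ` {X. feasible N k X})"
  have "{} \<in> {X. feasible N k X}" by (simp add: feasible_def)
  then have "?M \<in> f ` {X. feasible N k X}" using fin by (intro Max_in) auto
  then obtain X where "feasible N k X" "f X = ?M" by auto
  moreover have "f Y \<le> ?M" if "feasible N k Y" for Y using fin that by (intro Max_ge) auto
  ultimately show ?thesis
    unfolding optimal_solution_def is_arg_max_def by (auto simp: not_less)
qed

section \<open>Executing programs\<close>

fun loop_free :: "com \<Rightarrow> bool" where
  "loop_free (Seq c d) \<longleftrightarrow> loop_free c \<and> loop_free d"
| "loop_free (Branch b c d) \<longleftrightarrow> loop_free c \<and> loop_free d"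
| "loop_free (Loop b c) \<longleftrightarrow> False"
| "loop_free c \<longleftrightarrow> True"

fun run :: "'a list \<Rightarrow> ('a set \<Rightarrow> real) \<Rightarrow> com \<Rightarrow> 'a state \<Rightarrow> 'a state" where
  "run xs f (Do i) s = step xs f i s"
| "run xs f (Seq c d) s = run xs f d (run xs f c s)"
| "run xs f (Branch b c d) s = (if holds xs b s then run xs f c s else run xs f d s)"
| "run xs f c s = s"

text \<open>Worst-case time of loop-free code, whose final state is \<open>run\<close>. Together
  they reduce straight-line verification to rewriting; the values at loops are dummies, excluded by
  \<open>loop_free\<close>.\<close>

fun cost :: "com \<Rightarrow> nat" where
  "cost (Do i) = 1"
| "cost (Seq c d) = cost c + cost d"
| "cost (Branch b c d) = 1 + max (cost c) (cost d)"
| "cost c = 0"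

definition execs_within ::
  "'a list \<Rightarrow> ('a set \<Rightarrow> real) \<Rightarrow> com \<Rightarrow> 'a state \<Rightarrow> nat \<Rightarrow> 'a state \<Rightarrow> bool" where
  "execs_within xs f c s T s' \<longleftrightarrow> (\<exists>t\<le>T. exec xs f c s t s')"

lemma execs_within_run:
  "loop_free c \<Longrightarrow> execs_within xs f c s (cost c) (run xs f c s)"
proof (induction c arbitrary: s)
  case Skip
  then show ?case by (auto simp: execs_within_def intro: exec.Skip)
next
  case (Do i)
  have "exec xs f (Do i) s 1 (step xs f i s)" by (rule exec.Do)
  then show ?case by (auto simp: execs_within_def)
next
  case (Seq c d)
  then show ?case
    unfolding execs_within_def by simp (meson add_mono exec.Seq)
next
  case (Branch b c d)
  show ?case
  proof (cases "holds xs b s")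
    case True
    obtain t where "t \<le> cost c" "exec xs f c s t (run xs f c s)"
      using Branch unfolding execs_within_def by auto
    with True show ?thesis
      unfolding execs_within_def by (intro exI[of _ "1 + t"]) (auto intro: exec.BranchTrue[simplified])
  next
    case False
    obtain t where "t \<le> cost d" "exec xs f d s t (run xs f d s)"
      using Branch unfolding execs_within_def by auto
    with False show ?thesis
      unfolding execs_within_def by (intro exI[of _ "1 + t"]) (auto intro: exec.BranchFalse[simplified])
  qed
next
  case (Loop b c)
  then show ?case by simp
qed

lemma execs_within_Seq:
  assumes "execs_within xs f c s T s'" "execs_within xs f d s' U s''" "T + U \<le> W"
  shows "execs_within xs f (Seq c d) s W s''"
proof -
  obtain t u where "t \<le> T" "exec xs f c s t s'" "u \<le> U" "exec xs f d s' u s''"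
    using assms(1,2) unfolding execs_within_def by blast
  then show ?thesis
    using assms(3) unfolding execs_within_def by (intro exI[of _ "t + u"]) (auto intro: exec.Seq)
qed

text \<open>Each of the \<open>n\<close> rounds pays \<open>T\<close> for the body and 1 for the
  test; the last 1 is the failing test.\<close>

lemma execs_within_counted_loop:
  assumes start: "I 0 s"
    and test: "\<And>i s. i \<le> n \<Longrightarrow> I i s \<Longrightarrow> holds xs b s \<longleftrightarrow> i < n"
    and body: "\<And>i s. i < n \<Longrightarrow> I i s \<Longrightarrow> \<exists>s'. execs_within xs f c s T s' \<and> I (Suc i) s'"
  shows "\<exists>s'. execs_within xs f (Loop b c) s (n * (T + 1) + 1) s' \<and> I n s'"
proof -
  \<comment> \<open>Stated for any starting round so that induction on the remaining rounds
    \<open>n - i\<close> applies.\<close>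
  have "\<exists>s'. execs_within xs f (Loop b c) s ((n - i) * (T + 1) + 1) s' \<and> I n s'"
    if "i \<le> n" "I i s" for i s
    using that
  proof (induction "n - i" arbitrary: i s)
    case 0
    then have "\<not> holds xs b s" using test by auto
    then have "exec xs f (Loop b c) s 1 s" by (rule exec.LoopFalse)
    with 0 show ?case by (auto simp: execs_within_def)
  next
    case (Suc m)
    then have less: "i < n" by simp
    then obtain s1 t1 where s1: "t1 \<le> T" "exec xs f c s t1 s1" "I (Suc i) s1"
      using body[of i s] Suc.prems unfolding execs_within_def by blast
    obtain s2 t2 where s2: "t2 \<le> (n - Suc i) * (T + 1) + 1"
        "exec xs f (Loop b c) s1 t2 s2" "I n s2"
      using Suc.hyps(1)[of "Suc i" s1] Suc.hyps(2) less s1(3) unfolding execs_within_def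
      by fastforce
    have "exec xs f (Loop b c) s (1 + t1 + t2) s2"
      using test[of i s] Suc.prems less s1 s2 by (intro exec.LoopTrue) auto
    moreover have "n - i = Suc (n - Suc i)" using less by simp
    then have "1 + t1 + t2 \<le> (n - i) * (T + 1) + 1" using s1(1) s2(1) by simp
    ultimately show ?case using s2(3) unfolding execs_within_def by blast
  qed
  from this[of 0] start show ?thesis by simp
qed

section \<open>The algorithm\<close>

text \<open>
  Integer cells: 0 and 1 hold the inputs \<open>n\<close> and \<open>k\<close>, 2 the scan position, 3 the constant 1,
  4 the size of the solution, 5 and 6 the pass counter and its bound. Real cells: 0 holds the
  value of the current set, 1 the threshold, 2 and 3 are scratch, 4 holds \<open>k\<close>, 5 is never
  written and so stays 0, 6 holds the threshold ratio. Set cell 1 is \<open>A\<close>, set cell 0 the solution.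
\<close>

definition scan_body :: com where
  "scan_body = Seq (Do (SInsert 1 2)) (Seq (Do (Query 2 1)) (Seq (Do (RSub 3 2 0))
     (Seq (Do (RMul 3 3 4))
     (Seq (Branch (RLess 3 0) (Do (SRemove 1 2)) (Do (RAdd 0 5 2)))
       (Do (NAdd 2 2 3))))))"

text \<open>The membership test protects earlier acceptances: without it a rejection would delete
  such an element, and an acceptance would count it twice in cell 4.\<close>

definition pass_body :: com where
  "pass_body = Seq
     (Branch (NLess 4 1)
       (Branch (SMember 0 2) Skip
         (Seq (Do (SInsert 0 2)) (Seq (Do (Query 2 0)) (Seq (Do (RSub 3 2 0))
           (Branch (RLess 3 1) (Do (SRemove 0 2))
             (Seq (Do (RAdd 0 5 2)) (Do (NAdd 4 4 3))))))))
       Skip)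
     (Do (NAdd 2 2 3))"

definition init_scan :: com where
  "init_scan = Seq (Do (NConst 3 1)) (Seq (Do (ROfNat 4 1)) (Do (Query 0 1)))"

definition init_greedy :: "nat \<Rightarrow> com" where
  "init_greedy q = Seq (Do (RAdd 1 0 0)) (Seq (Do (RDiv 1 1 4))
     (Seq (Do (RConst 6 (1 - 1 / of_nat q))) (Seq (Do (NConst 6 (3 * q + 1))) (Do (Query 0 0)))))"

definition greedy_pass :: com where
  "greedy_pass = Seq (Do (NConst 2 0)) (Seq (Loop (NLess 2 0) pass_body)
     (Seq (Do (RMul 1 1 6)) (Do (NAdd 5 5 3))))"

definition smc_program :: "nat \<Rightarrow> com" where
  "smc_program q = Seq init_scan (Seq (Loop (NLess 2 0) scan_body)
     (Seq (init_greedy q) (Loop (NLess 5 6) greedy_pass)))"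

locale smc =
  fixes N :: "'a set" and xs :: "'a list" and k :: nat and f :: "'a set \<Rightarrow> real"
    and OPT :: "'a set"
  assumes inst: "smc_instance N k f"
    and enum: "set xs = N" "distinct xs"
    and opt: "optimal_solution N k f OPT"
begin

lemma instD:
  "finite N" "1 \<le> k" "nonnegative_on N f" "monotone_set_function_on N f" "submodular_on N f"
  using inst by (auto simp: smc_instance_def)

lemma opt_feasible: "feasible N k OPT"
  using opt by (simp add: optimal_solution_def is_arg_max_def)

lemma le_opt: "feasible N k X \<Longrightarrow> f X \<le> f OPT"
  using opt by (auto simp: optimal_solution_def is_arg_max_def not_less)

lemma nonneg: "X \<subseteq> N \<Longrightarrow> 0 \<le> f X"
  using instD(3) by (simp add: nonnegative_on_def)

lemma mono: "X \<subseteq> Y \<Longrightarrow> Y \<subseteq> N \<Longrightarrow> f X \<le> f Y"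
  using instD(4) by (simp add: monotone_set_function_on_def)

lemma nth_in: "i < length xs \<Longrightarrow> xs ! i \<in> N"
  using enum by auto

section \<open>The initial scan: a constant-factor estimate of the optimum\<close>

text \<open>
  The last clause is the induction-friendly form of ``the last \<open>j\<close> added elements carry all but a
  \<open>(1 + 1/k)\<^sup>-\<^sup>j\<close> fraction of the value''; it avoids recording the insertion order.
\<close>

definition scan_inv :: "nat \<Rightarrow> 'a set \<Rightarrow> bool" where
  "scan_inv i A \<longleftrightarrow> A \<subseteq> set (take i xs) \<and>
     (\<forall>l<i. f (A \<union> {xs ! l}) - f A \<le> f A / real k) \<and>
     (\<forall>j. \<exists>D\<subseteq>A. card D \<le> j \<and> f A - f D \<le> (real k / (real k + 1)) ^ j * f A)"

lemma scan_inv_0: "scan_inv 0 {}"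
  unfolding scan_inv_def using nonneg[of "{}"] by simp

lemma scan_inv_subset: "scan_inv i A \<Longrightarrow> A \<subseteq> N"
  using enum set_take_subset[of i xs] unfolding scan_inv_def by auto

text \<open>Ensures that removing a rejected element restores \<open>A\<close> exactly.\<close>

lemma scan_inv_notin:
  assumes "scan_inv i A" "i < length xs"
  shows "xs ! i \<notin> A"
proof -
  have "distinct (take (Suc i) xs)" using enum(2) by simp
  then have "xs ! i \<notin> set (take i xs)" using assms(2) by (simp add: take_Suc_conv_app_nth)
  then show ?thesis using assms(1) by (auto simp: scan_inv_def)
qed

lemma scan_inv_reject:
  assumes "scan_inv i A" "i < length xs" "(f (A \<union> {xs ! i}) - f A) * real k < f A"
  shows "scan_inv (Suc i) A"
proof -
  have "f (A \<union> {xs ! i}) - f A \<le> f A / real k"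
    using assms(3) instD(2) by (simp add: field_simps)
  then show ?thesis
    using assms(1,2) unfolding scan_inv_def by (auto simp: take_Suc_conv_app_nth less_Suc_eq)
qed

text \<open>Earlier gain bounds survive because gains shrink while \<open>f A / k\<close> grows. For
  the last clause, \<open>xs ! i\<close> is added to the witness for \<open>j - 1\<close>: its gain
  over that smaller set is at least its gain over \<open>A\<close>.\<close>

lemma scan_inv_accept:
  assumes inv: "scan_inv i A" and i: "i < length xs"
    and gain: "f A \<le> (f (A \<union> {xs ! i}) - f A) * real k"
  shows "scan_inv (Suc i) (A \<union> {xs ! i})"
proof -
  let ?u = "xs ! i" and ?B = "A \<union> {xs ! i}" and ?c = "real k / (real k + 1)"
  note sub = scan_inv_subset[OF inv] and u = nth_in[OF i]
  have le: "f A \<le> f ?B" using sub u by (intro mono) auto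
  have old: "f (?B \<union> {xs ! l}) - f ?B \<le> f ?B / real k" if "l < i" for l
  proof -
    have "f (?B \<union> {xs ! l}) - f ?B \<le> f (A \<union> {xs ! l}) - f A"
      using sub u that i nth_in by (intro gain_antimono[OF instD(5,4)]) auto
    also have "\<dots> \<le> f A / real k" using inv that by (simp add: scan_inv_def)
    also have "\<dots> \<le> f ?B / real k" using le by (intro divide_right_mono) auto
    finally show ?thesis .
  qed
  have new: "f (?B \<union> {?u}) - f ?B \<le> f ?B / real k"
    using nonneg[of ?B] sub u by (simp add: insert_absorb)
  have "\<exists>D\<subseteq>?B. card D \<le> j \<and> f ?B - f D \<le> ?c ^ j * f ?B" for j
  proof (cases j)
    case 0
    then show ?thesis using nonneg[of "{}"] by (intro exI[of _ "{}"]) auto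
  next
    case (Suc j')
    obtain D where D: "D \<subseteq> A" "card D \<le> j'" "f A - f D \<le> ?c ^ j' * f A"
      using inv unfolding scan_inv_def by blast
    have "f ?B - f A \<le> f (D \<union> {?u}) - f D"
      using D sub u by (intro gain_antimono[OF instD(5,4)]) auto
    then have "f ?B - f (D \<union> {?u}) \<le> ?c ^ j' * f A" using D(3) by linarith
    \<comment> \<open>The acceptance test rearranged: each addition shrinks the relative loss by
      another factor \<open>?c\<close>.\<close>
    also have "f A \<le> ?c * f ?B" using gain by (simp add: field_simps)
    then have "?c ^ j' * f A \<le> ?c ^ j' * (?c * f ?B)" by (intro mult_left_mono) auto
    also have "\<dots> = ?c ^ j * f ?B" using Suc by simp
    finally have "f ?B - f (D \<union> {?u}) \<le> ?c ^ j * f ?B" .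
    moreover have "card (D \<union> {?u}) \<le> j"
      using D(2) Suc card_Un_le[of D "{?u}"] by simp
    ultimately show ?thesis using D(1) by (intro exI[of _ "D \<union> {?u}"]) auto
  qed
  then show ?thesis
    using inv i old new unfolding scan_inv_def
    by (auto simp: take_Suc_conv_app_nth less_Suc_eq)
qed

text \<open>All gains are at most \<open>f A / k\<close>, so the gap to the optimum is at most
  \<open>f A\<close>. Conversely, the case \<open>j = k\<close> of the invariant yields a feasible
  \<open>D\<close> that misses at most half of \<open>f A\<close>, by Bernoulli.\<close>

lemma scan_value:
  assumes "scan_inv (length xs) A"
  shows "f OPT \<le> 2 * f A" "f A \<le> 2 * f OPT"
proof -
  note sub = scan_inv_subset[OF assms]
  have "f OPT - f A \<le> real k * (f A / real k)"
  proof (rule gap_le_card_times_gain[OF instD(5,4,1) sub opt_feasible])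
    fix u assume "u \<in> N"
    then obtain l where "l < length xs" "u = xs ! l" using enum by (metis in_set_conv_nth)
    then show "f (A \<union> {u}) - f A \<le> f A / real k" using assms by (simp add: scan_inv_def)
  qed (use nonneg[OF sub] in auto)
  then show "f OPT \<le> 2 * f A" using instD(2) by simp
  obtain D where D: "D \<subseteq> A" "card D \<le> k" "f A - f D \<le> (real k / (real k + 1)) ^ k * f A"
    using assms unfolding scan_inv_def by blast
  have "2 \<le> (1 + 1 / real k) ^ k"
    using Bernoulli_inequality[of "1 / real k" k] instD(2) order_trans[of "- 1" 0 "1 / real k"]
    by simp
  then have "1 / (1 + 1 / real k) ^ k \<le> 1 / 2" by (intro divide_left_mono) auto
  moreover have "real k / (real k + 1) = 1 / (1 + 1 / real k)"
    using instD(2) by (simp add: field_simps)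
  ultimately have "(real k / (real k + 1)) ^ k \<le> 1 / 2" by (simp only: power_one_over)
  then have "(real k / (real k + 1)) ^ k * f A \<le> 1 / 2 * f A"
    using nonneg[OF sub] by (rule mult_right_mono)
  moreover have "f D \<le> f OPT" using D sub by (intro le_opt) (auto simp: feasible_def)
  ultimately show "f A \<le> 2 * f OPT" using D(3) by linarith
qed

section \<open>Threshold greedy: invariants and approximation ratio\<close>

text \<open>Here \<open>\<tau> / a\<close> is the previous threshold. The power bound decides the
  case of a full solution, the bound by \<open>\<tau>\<close> the case of one that never fills
  up.\<close>

definition greedy_inv :: "real \<Rightarrow> real \<Rightarrow> 'a set \<Rightarrow> bool" where
  "greedy_inv a \<tau> S \<longleftrightarrow> S \<subseteq> N \<and> card S \<le> k \<and>
     f OPT - f S \<le> (1 - a / real k) ^ card S * f OPT \<and>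
     (card S < k \<longrightarrow> f OPT - f S \<le> real k * \<tau> / a)"

definition pass_inv :: "real \<Rightarrow> real \<Rightarrow> nat \<Rightarrow> 'a set \<Rightarrow> bool" where
  "pass_inv a \<tau> i S \<longleftrightarrow> greedy_inv a \<tau> S \<and>
     (card S < k \<longrightarrow> (\<forall>l<i. f (S \<union> {xs ! l}) - f S \<le> \<tau>))"

lemma pass_inv_skip:
  assumes "pass_inv a \<tau> i S" "card S < k \<Longrightarrow> f (S \<union> {xs ! i}) - f S \<le> \<tau>"
  shows "pass_inv a \<tau> (Suc i) S"
  using assms by (auto simp: pass_inv_def less_Suc_eq)

text \<open>The gap is at most \<open>k * \<tau> / a\<close>, so a gain of at least
  \<open>\<tau>\<close> closes an \<open>a / k\<close> fraction of it. Gains of elements already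
  scanned only shrink.\<close>

lemma pass_inv_accept:
  assumes inv: "pass_inv a \<tau> i S" and i: "i < length xs" and small: "card S < k"
    and new: "xs ! i \<notin> S" and gain: "\<tau> \<le> f (S \<union> {xs ! i}) - f S"
    and a: "0 < a" "a \<le> 1" and pos: "0 \<le> \<tau>"
  shows "pass_inv a \<tau> (Suc i) (S \<union> {xs ! i})"
proof -
  let ?u = "xs ! i" and ?B = "S \<union> {xs ! i}"
  have sub: "S \<subseteq> N" and gap: "f OPT - f S \<le> (1 - a / real k) ^ card S * f OPT"
    and gap': "f OPT - f S \<le> real k * \<tau> / a"
    using inv small by (auto simp: pass_inv_def greedy_inv_def)
  note u = nth_in[OF i]
  have card: "card ?B = Suc (card S)"
    using new sub instD(1) by (simp add: finite_subset)
  have "a / real k * (f OPT - f S) \<le> \<tau>"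
    using gap' a instD(2) by (simp add: field_simps)
  then have "f OPT - f ?B \<le> (1 - a / real k) * (f OPT - f S)"
    using gain by (simp add: algebra_simps)
  also have "\<dots> \<le> (1 - a / real k) * ((1 - a / real k) ^ card S * f OPT)"
    using gap a instD(2) by (intro mult_left_mono) (auto simp: field_simps)
  finally have 1: "f OPT - f ?B \<le> (1 - a / real k) ^ card ?B * f OPT"
    by (simp only: card power_Suc mult.assoc)
  have 2: "f OPT - f ?B \<le> real k * \<tau> / a" using gap' gain pos by linarith
  have 3: "f (?B \<union> {xs ! l}) - f ?B \<le> \<tau>" if "l < i" for l
  proof -
    have "f (?B \<union> {xs ! l}) - f ?B \<le> f (S \<union> {xs ! l}) - f S"
      using sub u that i nth_in by (intro gain_antimono[OF instD(5,4)]) auto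
    also have "\<dots> \<le> \<tau>" using inv that small by (simp add: pass_inv_def)
    finally show ?thesis .
  qed
  have 4: "f (?B \<union> {?u}) - f ?B \<le> \<tau>" using pos by (simp add: insert_absorb)
  show ?thesis
    using 1 2 3 4 sub u card small unfolding pass_inv_def greedy_inv_def
    by (auto simp: less_Suc_eq)
qed

text \<open>After a complete pass all gains are at most \<open>\<tau>\<close>, so the gap is at most
  \<open>k * \<tau>\<close>, which is the required bound for the next threshold
  \<open>\<tau> * a\<close>.\<close>

lemma pass_inv_end:
  assumes inv: "pass_inv a \<tau> (length xs) S" and a: "0 < a" and pos: "0 \<le> \<tau>"
  shows "greedy_inv a (\<tau> * a) S"
proof -
  have sub: "S \<subseteq> N" using inv by (auto simp: pass_inv_def greedy_inv_def)
  have "f OPT - f S \<le> real k * (\<tau> * a) / a" if small: "card S < k"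
  proof -
    have "f OPT - f S \<le> real k * \<tau>"
    proof (rule gap_le_card_times_gain[OF instD(5,4,1) sub opt_feasible _ pos])
      fix u assume "u \<in> N"
      then obtain l where "l < length xs" "u = xs ! l" using enum by (metis in_set_conv_nth)
      then show "f (S \<union> {u}) - f S \<le> \<tau>" using inv small by (simp add: pass_inv_def)
    qed
    then show ?thesis using a by simp
  qed
  then show ?thesis using inv by (auto simp: pass_inv_def greedy_inv_def)
qed

text \<open>If the solution is not full, one factor \<open>a\<close> of the exponent
  \<open>3 * q + 1\<close> cancels the division by \<open>a\<close>, and
  \<open>a ^ (3 * q) \<le> exp (- 3) \<le> 1 / (4 * exp 1)\<close> absorbs the factor 4 from
  \<open>2 * f A \<le> 4 * f OPT\<close>. If it is full, the ratio is at most
  \<open>exp (- a)\<close>, which exceeds \<open>1 / exp 1\<close> by at most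
  \<open>1 / q\<close>.\<close>

lemma greedy_value:
  assumes inv: "greedy_inv a (2 * f A / real k * a ^ (3 * q + 1)) S"
    and a: "a = 1 - 1 / real q" and q: "2 \<le> q" and A: "f A \<le> 2 * f OPT"
  shows "(1 - 1 / exp 1 - 1 / real q) * f OPT \<le> f S"
proof -
  let ?x = "1 / real q"
  have x: "0 < ?x" "?x \<le> 1 / 2" using q by (auto simp: field_simps)
  have apos: "0 < a" using x a by simp
  have V: "0 \<le> f OPT" using opt_feasible by (intro nonneg) (simp add: feasible_def)
  have e2: "2 \<le> exp (1::real)" using exp_ge_add_one_self[of 1] by simp
  have "f OPT - f S \<le> (1 / exp 1 + ?x) * f OPT"
  proof (cases "card S < k")
    case True
    have "a \<le> exp (- ?x)" using exp_ge_add_one_self[of "- ?x"] a by simp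
    then have "a ^ (3 * q) \<le> exp (- ?x) ^ (3 * q)" using apos by (intro power_mono) auto
    also have "\<dots> = exp (- 3)" using q by (simp flip: exp_of_nat_mult)
    also have "\<dots> = 1 / (exp 1 * (exp 1 * exp 1))" by (simp add: exp_minus field_simps flip: exp_add)
    also have "\<dots> \<le> 1 / (exp 1 * (2 * 2))"
      using e2 by (intro divide_left_mono mult_left_mono mult_mono) auto
    finally have pw: "a ^ (3 * q) \<le> 1 / (exp 1 * 4)" by simp
    have "f OPT - f S \<le> real k * (2 * f A / real k * a ^ (3 * q + 1)) / a"
      using inv True by (simp add: greedy_inv_def)
    also have "\<dots> = 2 * f A * a ^ (3 * q)" using apos instD(2) by simp
    also have "\<dots> \<le> 4 * f OPT * a ^ (3 * q)" using A apos by (intro mult_right_mono) auto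
    also have "\<dots> \<le> 4 * f OPT * (1 / (exp 1 * 4))" using pw V by (intro mult_left_mono) auto
    also have "\<dots> \<le> (1 / exp 1 + ?x) * f OPT" using V x by (simp add: algebra_simps)
    finally show ?thesis .
  next
    case False
    then have card: "card S = k" using inv by (simp add: greedy_inv_def)
    \<comment> \<open>Makes the base \<open>1 - a / k\<close> nonnegative, so that powers preserve
      the inequality.\<close>
    have "a \<le> real k" using a x(1) instD(2) by linarith
    then have "(1 - a / real k) ^ k \<le> exp (- a / real k) ^ k"
      using exp_ge_add_one_self[of "- a / real k"] instD(2)
      by (intro power_mono) (auto simp: field_simps)
    also have "\<dots> = exp (- a)" using instD(2) by (simp flip: exp_of_nat_mult)
    also have "\<dots> = exp ?x / exp 1" using a by (simp flip: exp_diff)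
    \<comment> \<open>As \<open>?x \<le> 1\<close>, the quadratic bound on \<open>exp\<close> gives
      \<open>exp ?x \<le> 1 + 2 * ?x\<close>; the surplus \<open>2 * ?x / exp 1\<close> is at most
      \<open>?x\<close> because \<open>exp 1 \<ge> 2\<close>.\<close>
    also have "exp ?x \<le> 1 + ?x + ?x\<^sup>2" using x by (intro exp_bound) auto
    also have "?x\<^sup>2 \<le> ?x" using x by (simp add: power2_eq_square field_simps)
    also have "(1 + ?x + ?x) / exp 1 = 1 / exp 1 + 2 * ?x / exp 1"
      by (simp add: add_divide_distrib)
    also have "2 * ?x / exp 1 \<le> ?x" using e2 x by (simp add: field_simps)
    finally have "(1 - a / real k) ^ k \<le> 1 / exp 1 + ?x"
      by (simp add: divide_right_mono add_divide_distrib)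
    then have "(1 - a / real k) ^ k * f OPT \<le> (1 / exp 1 + ?x) * f OPT"
      using V by (rule mult_right_mono)
    then show ?thesis using inv card by (simp add: greedy_inv_def)
  qed
  then show ?thesis by (simp add: algebra_simps)
qed

section \<open>Correctness and running time of the program\<close>

lemmas exec_simps = set_nmem_def set_rmem_def set_smem_def element_at_def

text \<open>The clauses on integer cells 4 and 5 and on set cell 0 carry their initial values
  through the scan to the greedy phase.\<close>

definition scan_state :: "nat \<Rightarrow> 'a state \<Rightarrow> bool" where
  "scan_state i s \<longleftrightarrow> nmem s 0 = length xs \<and> nmem s 1 = k \<and> nmem s 2 = i \<and> nmem s 3 = 1 \<and>
     nmem s 4 = 0 \<and> nmem s 5 = 0 \<and> rmem s 0 = f (smem s 1) \<and> rmem s 4 = real k \<and>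
     rmem s 5 = 0 \<and> smem s 0 = {} \<and> scan_inv i (smem s 1)"

lemma scan_body_correct:
  assumes "i < length xs" "scan_state i s"
  shows "\<exists>s'. execs_within xs f scan_body s 7 s' \<and> scan_state (Suc i) s'"
proof -
  have lf: "loop_free scan_body" "cost scan_body = 7" by (simp_all add: scan_body_def)
  have s: "scan_inv i (smem s 1)" "nmem s 2 = i" using assms(2) by (auto simp: scan_state_def)
  have "scan_state (Suc i) (run xs f scan_body s)"
    using assms scan_inv_reject[OF s(1) assms(1)] scan_inv_accept[OF s(1) assms(1)]
      scan_inv_notin[OF s(1) assms(1)]
    by (auto simp: scan_body_def scan_state_def exec_simps not_less)
  then show ?thesis using execs_within_run[OF lf(1), of xs f s] lf(2) by auto
qed

definition greedy_state :: "real \<Rightarrow> nat \<Rightarrow> real \<Rightarrow> nat \<Rightarrow> 'a state \<Rightarrow> bool" where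
  "greedy_state a m \<tau> p s \<longleftrightarrow> nmem s 0 = length xs \<and> nmem s 1 = k \<and> nmem s 3 = 1 \<and>
     nmem s 4 = card (smem s 0) \<and> nmem s 5 = p \<and> nmem s 6 = m \<and> rmem s 0 = f (smem s 0) \<and>
     rmem s 1 = \<tau> \<and> rmem s 5 = 0 \<and> rmem s 6 = a"

lemma pass_body_correct:
  assumes i: "i < length xs" and a: "0 < a" "a \<le> 1" and pos: "0 \<le> \<tau>"
    and s: "greedy_state a m \<tau> p s" "nmem s 2 = i" "pass_inv a \<tau> i (smem s 0)"
  shows "\<exists>s'. execs_within xs f pass_body s 9 s' \<and>
    (greedy_state a m \<tau> p s' \<and> nmem s' 2 = Suc i \<and> pass_inv a \<tau> (Suc i) (smem s' 0))"
proof -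
  have lf: "loop_free pass_body" "cost pass_body = 9" by (simp_all add: pass_body_def)
  let ?S = "smem s 0" and ?s = "run xs f pass_body s"
  have fin: "finite ?S"
    using s(3) instD(1) by (auto simp: pass_inv_def greedy_inv_def intro: finite_subset)
  have "greedy_state a m \<tau> p ?s \<and> nmem ?s 2 = Suc i \<and> pass_inv a \<tau> (Suc i) (smem ?s 0)"
  proof (cases "card ?S < k \<and> xs ! i \<notin> ?S")
    \<comment> \<open>The solution stays unchanged: it is full, or the element already belongs to it
      and has gain 0.\<close>
    case False
    then have "pass_inv a \<tau> (Suc i) ?S"
      using s(3) pos by (intro pass_inv_skip) (auto simp: insert_absorb)
    with False show ?thesis
      using s i by (auto simp: pass_body_def greedy_state_def exec_simps)
  next
    case True
    show ?thesis
    proof (cases "f (?S \<union> {xs ! i}) - f ?S < \<tau>")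
      case less: True
      then have "pass_inv a \<tau> (Suc i) ?S" using s(3) by (intro pass_inv_skip) auto
      with less True show ?thesis
        using s i by (auto simp: pass_body_def greedy_state_def exec_simps)
    next
      case False
      then have "pass_inv a \<tau> (Suc i) (?S \<union> {xs ! i})"
        using s(3) i True a pos by (intro pass_inv_accept) auto
      with False True show ?thesis
        using s i fin by (auto simp: pass_body_def greedy_state_def exec_simps)
    qed
  qed
  then show ?thesis using execs_within_run[OF lf(1), of xs f s] lf(2) by auto
qed

lemma greedy_pass_correct:
  assumes a: "0 < a" "a \<le> 1" and pos: "0 \<le> \<tau>"
    and s: "greedy_state a m \<tau> p s" "greedy_inv a \<tau> (smem s 0)"
  shows "\<exists>s'. execs_within xs f greedy_pass s (10 * length xs + 4) s' \<and>
    (greedy_state a m (\<tau> * a) (Suc p) s' \<and> greedy_inv a (\<tau> * a) (smem s' 0))"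
proof -
  let ?I = "\<lambda>i s. greedy_state a m \<tau> p s \<and> nmem s 2 = i \<and> pass_inv a \<tau> i (smem s 0)"
  let ?c0 = "Do (NConst 2 0)" and ?c1 = "Seq (Do (RMul 1 1 6)) (Do (NAdd 5 5 3))"
  have "?I 0 (run xs f ?c0 s)"
    using s by (simp add: greedy_state_def pass_inv_def exec_simps)
  then have "\<exists>s'. execs_within xs f (Loop (NLess 2 0) pass_body) (run xs f ?c0 s)
      (length xs * (9 + 1) + 1) s' \<and> ?I (length xs) s'"
    by (rule execs_within_counted_loop)
      (use pass_body_correct[OF _ a pos] in \<open>auto simp: greedy_state_def\<close>)
  then obtain s1 where s1: "execs_within xs f (Loop (NLess 2 0) pass_body) (run xs f ?c0 s)
      (length xs * (9 + 1) + 1) s1" "?I (length xs) s1" by blast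
  have "greedy_inv a (\<tau> * a) (smem s1 0)" using s1(2) a pos by (intro pass_inv_end) auto
  then have "greedy_state a m (\<tau> * a) (Suc p) (run xs f ?c1 s1) \<and>
      greedy_inv a (\<tau> * a) (smem (run xs f ?c1 s1) 0)"
    using s1(2) by (simp add: greedy_state_def exec_simps)
  \<comment> \<open>Each position costs 9 for the body and 1 for the test; the 4 is one reset, the
    failing test and two updates.\<close>
  moreover have "execs_within xs f greedy_pass s (10 * length xs + 4) (run xs f ?c1 s1)"
    unfolding greedy_pass_def
    by (rule execs_within_Seq[OF execs_within_run execs_within_Seq[OF s1(1) execs_within_run]])
      (auto intro: order_refl)
  ultimately show ?thesis by blast
qed

lemma smc_program_correct:
  assumes q: "2 \<le> q"
  shows "\<exists>t S. outputs_in_time (smc_program q) xs k f t S \<and>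
    t \<le> 132 * q * length xs \<and> feasible N k S \<and>
    (1 - 1 / exp 1 - 1 / real q) * f OPT \<le> f S"
proof -
  let ?n = "length xs" and ?m = "3 * q + 1" and ?s = "initial_state (length xs) k"
  define a where "a = 1 - 1 / real q"
  have a: "0 < a" "a \<le> 1" using q by (auto simp: a_def)
  \<comment> \<open>Lets additive constants be absorbed into multiples of the input length.\<close>
  have n: "1 \<le> ?n"
    using inst enum distinct_card[of xs] by (auto simp: smc_instance_def)
  have "scan_state 0 (run xs f init_scan ?s)"
    using scan_inv_0 by (simp add: scan_state_def init_scan_def initial_state_def exec_simps)
  then have "\<exists>s'. execs_within xs f (Loop (NLess 2 0) scan_body) (run xs f init_scan ?s)
      (?n * (7 + 1) + 1) s' \<and> scan_state ?n s'"
    by (rule execs_within_counted_loop) (use scan_body_correct in \<open>auto simp: scan_state_def\<close>)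
  then obtain s1 where s1: "execs_within xs f (Loop (NLess 2 0) scan_body)
      (run xs f init_scan ?s) (?n * (7 + 1) + 1) s1" "scan_state ?n s1" by blast
  define A where "A = smem s1 1"
  define \<tau> where "\<tau> = 2 * f A / real k"
  let ?s2 = "run xs f (init_greedy q) s1"
  let ?I = "\<lambda>p s. greedy_state a ?m (\<tau> * a ^ p) p s \<and> greedy_inv a (\<tau> * a ^ p) (smem s 0)"
  have A: "scan_inv ?n A" using s1(2) by (simp add: A_def scan_state_def)
  have \<tau>: "0 \<le> \<tau>" using nonneg[OF scan_inv_subset[OF A]] by (simp add: \<tau>_def)
  \<comment> \<open>The lower bound on \<open>f A\<close> makes the initial threshold high enough
    for the invariant to hold at the empty set, before any pass.\<close>
  have "f OPT \<le> real k * \<tau>" using scan_value(1)[OF A] instD(2) by (simp add: \<tau>_def)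
  also have "\<dots> \<le> real k * \<tau> / a" using a \<tau> by (simp add: le_divide_eq mult_left_le)
  finally have "greedy_inv a \<tau> {}"
    using nonneg[of "{}"] by (simp add: greedy_inv_def)
  then have "?I 0 ?s2"
    using s1(2) by (simp add: greedy_state_def scan_state_def init_greedy_def exec_simps
        \<tau>_def A_def a_def of_rat_diff of_rat_divide)
  then have "\<exists>s'. execs_within xs f (Loop (NLess 5 6) greedy_pass) ?s2
      (?m * ((10 * ?n + 4) + 1) + 1) s' \<and> ?I ?m s'"
  proof (rule execs_within_counted_loop)
    fix p s assume "?I p s"
    then show "\<exists>s'. execs_within xs f greedy_pass s (10 * ?n + 4) s' \<and> ?I (Suc p) s'"
      using greedy_pass_correct[OF a, of "\<tau> * a ^ p" ?m p s] \<tau> a by (simp add: mult_ac)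
  qed (auto simp: greedy_state_def)
  then obtain s3 where s3: "execs_within xs f (Loop (NLess 5 6) greedy_pass) ?s2
      (?m * ((10 * ?n + 4) + 1) + 1) s3" "?I ?m s3" by blast
  \<comment> \<open>Naming the product makes the remaining time estimate linear arithmetic.\<close>
  define y where "y = q * ?n"
  have "2 * ?n \<le> y" unfolding y_def using q by (intro mult_right_mono) auto
  moreover have "?m * ((10 * ?n + 4) + 1) \<le> (4 * q) * (15 * ?n)"
    using q n by (intro mult_mono) auto
  then have "?m * ((10 * ?n + 4) + 1) \<le> 60 * y" by (simp add: y_def)
  moreover have "3 + (l * (7 + 1) + 1 + (5 + (x + 1))) \<le> 132 * y"
    if "2 * l \<le> y" "x \<le> 60 * y" "1 \<le> l" for l x using that by simp
  ultimately have "3 + (?n * (7 + 1) + 1 + (5 + (?m * ((10 * ?n + 4) + 1) + 1))) \<le> 132 * y"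
    using n by blast
  then have time: "3 + (?n * (7 + 1) + 1 + (5 + (?m * ((10 * ?n + 4) + 1) + 1)))
      \<le> 132 * q * ?n" by (simp only: y_def mult.assoc)
  have "execs_within xs f (smc_program q) ?s (132 * q * ?n) s3"
    unfolding smc_program_def
    by (rule execs_within_Seq[OF execs_within_run execs_within_Seq[OF s1(1)
          execs_within_Seq[OF execs_within_run s3(1)]] time[THEN order_trans[rotated]]])
      (auto simp: init_scan_def init_greedy_def)
  then have "\<exists>t. outputs_in_time (smc_program q) xs k f t (smem s3 0) \<and> t \<le> 132 * q * ?n"
    unfolding execs_within_def outputs_in_time_def by blast
  moreover have "feasible N k (smem s3 0)"
    using s3(2) by (simp add: greedy_inv_def feasible_def)
  moreover have "(1 - 1 / exp 1 - 1 / real q) * f OPT \<le> f (smem s3 0)"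
    using s3(2) greedy_value[of a A q "smem s3 0"] scan_value(2)[OF A] q
    by (simp add: a_def \<tau>_def)
  ultimately show ?thesis by blast
qed

end

section \<open>Choosing the parameter \<open>q\<close> from the accuracy\<close>

theorem theorem1:
  "\<exists>C::real. C > 0 \<and> (\<forall>\<epsilon>::real. \<epsilon> > 0 \<longrightarrow>
     (\<exists>P::com. \<forall>(N::'a set) (xs::'a list) (k::nat) (f::'a set \<Rightarrow> real).
        smc_instance N k f \<and> set xs = N \<and> distinct xs \<longrightarrow>
        (\<exists>t S. outputs_in_time P xs k f t S \<and>
           real t \<le> C * (real (card N) / \<epsilon>) \<and>
           feasible N k S \<and>
           (\<forall>OPT. optimal_solution N k f OPT \<longrightarrow>
              f S \<ge> (1 - 1 / exp 1 - \<epsilon>) * f OPT))))"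
\<comment> \<open>264 is twice the 132 of \<open>smc_program_correct\<close>, because
  \<open>q \<le> 2 / \<epsilon>\<close>.\<close>
proof (intro exI[of _ 264] conjI allI impI)
  fix \<epsilon> :: real
  assume \<epsilon>: "\<epsilon> > 0"
  show "\<exists>P::com. \<forall>(N::'a set) (xs::'a list) (k::nat) (f::'a set \<Rightarrow> real).
        smc_instance N k f \<and> set xs = N \<and> distinct xs \<longrightarrow>
        (\<exists>t S. outputs_in_time P xs k f t S \<and>
           real t \<le> 264 * (real (card N) / \<epsilon>) \<and>
           feasible N k S \<and>
           (\<forall>OPT. optimal_solution N k f OPT \<longrightarrow>
              f S \<ge> (1 - 1 / exp 1 - \<epsilon>) * f OPT))"
  proof (cases "\<epsilon> < 1")
    case False
    \<comment> \<open>The guarantee is vacuous, but for large \<open>\<epsilon>\<close> the time bound only admits the empty program.\<close>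
    show ?thesis
    proof (intro exI[of _ Skip] allI impI)
      fix N :: "'a set" and xs k f
      assume inst: "smc_instance N k f \<and> set xs = N \<and> distinct xs"
      have out: "outputs_in_time Skip xs k f 0 {}"
        unfolding outputs_in_time_def
        by (intro exI[of _ "initial_state (length xs) k"]) (simp add: exec.Skip initial_state_def)
      have val: "(1 - 1 / exp 1 - \<epsilon>) * f OPT \<le> f {}" if "optimal_solution N k f OPT" for OPT
      proof -
        have "0 \<le> f {}" "0 \<le> f OPT"
          using inst that by (auto simp: smc_instance_def nonnegative_on_def
              optimal_solution_def is_arg_max_def feasible_def)
        moreover have "1 - 1 / exp 1 - \<epsilon> \<le> 0"
          using False exp_gt_zero[of "1::real"] by (smt (verit) divide_pos_pos)
        ultimately show ?thesis by (smt (verit) mult_nonpos_nonneg)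
      qed
      show "\<exists>t S. outputs_in_time Skip xs k f t S \<and> real t \<le> 264 * (real (card N) / \<epsilon>) \<and>
          feasible N k S \<and> (\<forall>OPT. optimal_solution N k f OPT \<longrightarrow>
            f S \<ge> (1 - 1 / exp 1 - \<epsilon>) * f OPT)"
        using out val \<epsilon> by (intro exI[of _ 0] exI[of _ "{}"]) (auto simp: feasible_def)
    qed
  next
    case True
    \<comment> \<open>Rounding up gives \<open>1 / q \<le> \<epsilon>\<close>; since
      \<open>1 / \<epsilon> > 1\<close>, it at most doubles \<open>1 / \<epsilon>\<close> and yields
      \<open>q \<ge> 2\<close>.\<close>
    define q where "q = nat \<lceil>1 / \<epsilon>\<rceil>"
    have "1 < 1 / \<epsilon>" using True \<epsilon> by simp
    then have q: "2 \<le> q" "1 / \<epsilon> \<le> real q" "real q \<le> 2 / \<epsilon>"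
      unfolding q_def by linarith+
    have q\<epsilon>: "1 / real q \<le> \<epsilon>" using q \<epsilon> by (simp add: field_simps)
    show ?thesis
    proof (intro exI[of _ "smc_program q"] allI impI)
      fix N :: "'a set" and xs k f
      assume inst: "smc_instance N k f \<and> set xs = N \<and> distinct xs"
      then obtain X where X: "optimal_solution N k f X"
        using optimal_solution_exists by (metis smc_instance_def)
      interpret smc N xs k f X using inst X by unfold_locales auto
      obtain t S where tS: "outputs_in_time (smc_program q) xs k f t S"
          "t \<le> 132 * q * length xs" "feasible N k S"
          "(1 - 1 / exp 1 - 1 / real q) * f X \<le> f S"
        using smc_program_correct[OF q(1)] by blast
      have len: "length xs = card N" using enum distinct_card[of xs] by simp
      have "real t \<le> real (132 * q * length xs)" using tS(2) by (simp only: of_nat_le_iff)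
      also have "\<dots> = 132 * real (card N) * real q" using len by simp
      also have "\<dots> \<le> 132 * real (card N) * (2 / \<epsilon>)" using q by (intro mult_left_mono) auto
      finally have time: "real t \<le> 264 * (real (card N) / \<epsilon>)" by simp
      \<comment> \<open>The locale fixes one optimum \<open>X\<close>; any other optimum has the
        same value, so the bound transfers.\<close>
      have "(1 - 1 / exp 1 - \<epsilon>) * f Y \<le> f S" if "optimal_solution N k f Y" for Y
      proof -
        have Y: "feasible N k Y"
          using that by (simp add: optimal_solution_def is_arg_max_def)
        then have "f Y = f X"
          using le_opt[OF Y] that opt_feasible
          by (force simp: optimal_solution_def is_arg_max_def not_less)
        moreover have "0 \<le> f Y" using Y by (intro nonneg) (simp add: feasible_def)
        then have "(1 - 1 / exp 1 - \<epsilon>) * f Y \<le> (1 - 1 / exp 1 - 1 / real q) * f Y"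
          using q\<epsilon> by (intro mult_right_mono) auto
        ultimately show ?thesis using tS(4) by simp
      qed
      then show "\<exists>t S. outputs_in_time (smc_program q) xs k f t S \<and>
          real t \<le> 264 * (real (card N) / \<epsilon>) \<and> feasible N k S \<and>
          (\<forall>OPT. optimal_solution N k f OPT \<longrightarrow> f S \<ge> (1 - 1 / exp 1 - \<epsilon>) * f OPT)"
        using tS time by blast
    qed
  qed
qed simp

end
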